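(* Let $\widetilde{m}\in\{0,1\}^d$ have exactly $k$ nonzero components, let $\lambda>0$, and let $\mathcal{L}:\mathbb{R}^d\to\mathbb{R}$ be differentiable at $\widetilde{m}$ with $\|\nabla\mathcal{L}(\widetilde{m})\|_\infty\le\lambda$. Let $\mathtt{R}(m)=\sum_{i=1}^d\mathtt{r}(m_i)$ for $m\in[0,1]^d$, where $\mathtt{r}:[0,1]\to[0,1]$ is either $\mathtt{r}(t)=t$ (so that $\mathtt{R}=\|\cdot\|_1$) or a function that is continuous, differentiable in $(0,1)$, strictly concave, non-decreasing, and has image $[0,1]$. Let $$m^\star\in\operatorname*{argmin}_{m\in[0,1]^d}\ \mathcal{L}(m)+\lambda\,\mathtt{R}(m).$$ Let $\gamma>0$ be such that $$\mathcal{L}(m^\star)\ \ge\ \mathcal{L}(\widetilde{m})+\nabla\mathcal{L}(\widetilde{m})^T(m^\star-\widetilde{m})+\frac{\gamma}{2}\|m^\star-\widetilde{m}\|_2^2 .$$ If $\frac{4\sqrt{k}}{\gamma}\lambda<1$ and $m^\star\in\{0,1\}^d$, then $m^\star=\widetilde{m}$.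
   Context: Here $\mathcal{L}(m)$ stands for the loss $\mathcal{L}(x;m\odot\theta)$ of a model with fixed input data $x$ and fixed trained parameter vector $\theta\in\mathbb{R}^d$, seen as a function of the mask $m$ only; $\odot$ is the componentwise product. The vector $\widetilde{m}$ is the (unknown) target binary mask, $m^\star$ is its estimate, and $\mathtt{R}$ is the regularizer. The norms are $\|v\|_1=\sum_i|v_i|$, $\|v\|_2=(\sum_i v_i^2)^{1/2}$, $\|v\|_\infty=\max_i|v_i|$. *)

theory Defs
  imports "HOL-Analysis.Analysis"
begin

definition binary_masks :: "(real ^ 'd) set" where
  "binary_masks = {m. \<forall>i. m $ i \<in> {0, 1}}"

definition relaxed_masks :: "(real ^ 'd) set" where
  "relaxed_masks = {m. \<forall>i. m $ i \<in> {0..1}}"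

definition strictly_concave_on :: "real set \<Rightarrow> (real \<Rightarrow> real) \<Rightarrow> bool" where
  "strictly_concave_on S f \<longleftrightarrow> convex S \<and>
     (\<forall>x\<in>S. \<forall>y\<in>S. \<forall>u>0. \<forall>v>0. x \<noteq> y \<longrightarrow> u + v = 1 \<longrightarrow>
        f (u * x + v * y) > u * f x + v * f y)"

(* A function on [0,1] is represented by a total function of which only the
   values on {0..1} are constrained or used. *)
definition concave_penalty :: "(real \<Rightarrow> real) \<Rightarrow> bool" where
  "concave_penalty r \<longleftrightarrow>
     continuous_on {0..1} r \<and>
     r differentiable_on {0<..<1} \<and>
     strictly_concave_on {0..1} r \<and>
     mono_on {0..1} r \<and>
     r ` {0..1} = {0..1}"

definition separable_reg :: "(real \<Rightarrow> real) \<Rightarrow> real ^ 'd \<Rightarrow> real" where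
  "separable_reg r m = (\<Sum>i\<in>UNIV. r (m $ i))"

end

theory Submission
  imports Defs
begin

text \<open>
  Write \<open>D = mstar - mtilde\<close> and let \<open>S\<close> be the support of \<open>mtilde\<close>. Both masks are binary and \<open>r\<close>
  fixes 0 and 1, so the regularizer agrees on them with the sum of the components. Minimality of
  \<open>mstar\<close> and the curvature condition give
  \<open>gam / 2 * norm D ^ 2 \<le> (\<Sum>i. - g i * D i - lam * D i)\<close>. Off \<open>S\<close> one has \<open>D i \<ge> 0\<close>, so that
  \<open>\<bar>g i\<bar> \<le> lam\<close> makes the summand nonpositive; on \<open>S\<close> it is at most \<open>2 * lam * (D i)^2\<close>. If \<open>S\<close> is
  empty, \<open>D\<close> vanishes; otherwise \<open>4 * lam < gam\<close>, because \<open>sqrt k \<ge> 1\<close>, and \<open>D\<close> vanishes again.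
\<close>

text \<open>Surjectivity provides points \<open>a\<close> and \<open>b\<close> with values 0 and 1;
  monotonicity from 0 to \<open>a\<close> and from \<open>b\<close> to 1 then forces the endpoint
  values.\<close>

lemma concave_penalty_endpoints:
  assumes "concave_penalty r"
  shows "r 0 = 0" and "r 1 = 1"
proof -
  have mono: "mono_on {0..1} r" and img: "r ` {0..1} = {0..1}"
    using assms by (auto simp: concave_penalty_def)
  have range: "r 0 \<in> {0..1}" "r 1 \<in> {0..1}"
    using img by (metis atLeastAtMost_iff imageI order_refl zero_le_one)+
  obtain a b where "a \<in> {0..1}" "r a = 0" "b \<in> {0..1}" "r b = 1"
    using img by (metis atLeastAtMost_iff imageE order_refl zero_le_one)
  with range mono_onD[OF mono, of 0 a] mono_onD[OF mono, of b 1]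
  show "r 0 = 0" "r 1 = 1" by auto
qed

lemma binary_masks_subset_relaxed_masks: "binary_masks \<subseteq> relaxed_masks"
proof
  fix m :: "real ^ 'd"
  assume m: "m \<in> binary_masks"
  have "m $ i \<in> {0..1}" for i
  proof -
    have "m $ i \<in> {0, 1}" using m by (simp add: binary_masks_def)
    then show ?thesis by auto
  qed
  then show "m \<in> relaxed_masks" by (simp add: relaxed_masks_def)
qed

lemma separable_reg_binary:
  assumes "r 0 = 0" "r 1 = 1" "m \<in> binary_masks"
  shows "separable_reg r m = (\<Sum>i\<in>UNIV. m $ i)"
  unfolding separable_reg_def
proof (rule sum.cong)
  fix i
  have "m $ i \<in> {0, 1}" using assms(3) by (simp add: binary_masks_def)
  then show "r (m $ i) = m $ i" using assms(1,2) by auto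
qed simp

lemma norm_power2_cart: "(norm v)\<^sup>2 = (\<Sum>i\<in>UNIV. (v $ i)\<^sup>2)" for v :: "real ^ 'd"
  unfolding power2_norm_eq_inner inner_vec_def by (simp add: power2_eq_square)

text \<open>The left side is \<open>- (g + lam) * (y - x)\<close> with
  \<open>0 \<le> g + lam \<le> 2 * lam\<close>. A bit can only go up from \<open>x = 0\<close>,
  giving a value at most 0; dropping from 1 to 0 gives \<open>g + lam\<close>, while the square is
  1.\<close>

lemma coordinate_bound:
  fixes x y g lam :: real
  assumes "x \<in> {0, 1}" "y \<in> {0, 1}" "\<bar>g\<bar> \<le> lam"
  shows "- g * (y - x) - lam * (y - x) \<le> 2 * lam * (if x \<noteq> 0 then (y - x)\<^sup>2 else 0)"
  using assms by auto

theorem lemma1: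
  fixes L :: "real ^ 'd \<Rightarrow> real"
    and g mtilde mstar :: "real ^ 'd"
    and r :: "real \<Rightarrow> real"
    and lam gam :: real
    and k :: nat
  assumes "mtilde \<in> binary_masks"
    and "card {i. mtilde $ i \<noteq> 0} = k"
    and "lam > 0"
    and "GDERIV L mtilde :> g"
    and "infnorm g \<le> lam"
    and "(\<forall>t\<in>{0..1}. r t = t) \<or> concave_penalty r"
    and "is_arg_min (\<lambda>m. L m + lam * separable_reg r m) (\<lambda>m. m \<in> relaxed_masks) mstar"
    and "gam > 0"
    and "L mstar \<ge> L mtilde + g \<bullet> (mstar - mtilde) + gam / 2 * (norm (mstar - mtilde))\<^sup>2"
    and "4 * sqrt (real k) / gam * lam < 1"
    and "mstar \<in> binary_masks"
  shows "mstar = mtilde"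
proof -
  define D where "D = mstar - mtilde"
  define S where "S = {i. mtilde $ i \<noteq> 0}"
  have r: "r 0 = 0" "r 1 = 1"
    using assms(6) concave_penalty_endpoints by auto
  \<comment> \<open>The binary mask \<open>mtilde\<close> is a feasible competitor in the relaxed
    problem.\<close>
  have "L mstar + lam * separable_reg r mstar \<le> L mtilde + lam * separable_reg r mtilde"
    using assms(1,7) binary_masks_subset_relaxed_masks by (force simp: is_arg_min_linorder)
  then have "L mstar - L mtilde \<le> lam * (\<Sum>i\<in>UNIV. mtilde $ i) - lam * (\<Sum>i\<in>UNIV. mstar $ i)"
    using separable_reg_binary[OF r assms(1)] separable_reg_binary[OF r assms(11)] by simp
  then have "gam / 2 * (norm D)\<^sup>2 \<le> - (g \<bullet> D) - lam * (\<Sum>i\<in>UNIV. D $ i)"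
    using assms(9) by (simp add: D_def sum_subtractf right_diff_distrib)
  also have "\<dots> = (\<Sum>i\<in>UNIV. - g $ i * D $ i - lam * D $ i)"
    by (simp add: inner_vec_def sum_subtractf sum_negf sum_distrib_left)
  also have "\<dots> \<le> (\<Sum>i\<in>UNIV. 2 * lam * (if i \<in> S then (D $ i)\<^sup>2 else 0))"
  proof (rule sum_mono)
    fix i
    have "\<bar>g $ i\<bar> \<le> lam"
      using component_le_infnorm_cart[of g i] assms(5) by linarith
    moreover have "mtilde $ i \<in> {0, 1}" "mstar $ i \<in> {0, 1}"
      using assms(1,11) by (simp_all add: binary_masks_def)
    ultimately show "- g $ i * D $ i - lam * D $ i \<le> 2 * lam * (if i \<in> S then (D $ i)\<^sup>2 else 0)"
      using coordinate_bound[of "mtilde $ i" "mstar $ i" "g $ i" lam]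
      by (simp only: D_def S_def mem_Collect_eq vector_minus_component)
  qed
  also have "\<dots> = 2 * lam * (\<Sum>i\<in>S. (D $ i)\<^sup>2)"
    by (simp add: sum_distrib_left[symmetric] sum.If_cases)
  finally have main: "gam / 2 * (norm D)\<^sup>2 \<le> 2 * lam * (\<Sum>i\<in>S. (D $ i)\<^sup>2)" .
  have "(norm D)\<^sup>2 \<le> 0"
  proof (cases "k = 0")
    case True
    then have "S = {}" using assms(2) by (simp add: S_def)
    then show ?thesis using main \<open>gam > 0\<close> by (simp add: mult_le_0_iff)
  next
    case False
    then have "1 \<le> sqrt (real k)" by simp
    then have "4 * lam \<le> 4 * sqrt (real k) * lam" using \<open>lam > 0\<close> by simp
    also have "\<dots> < gam" using assms(10) \<open>gam > 0\<close> by (simp add: field_simps)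
    finally have gap: "4 * lam < gam" .
    have "(\<Sum>i\<in>S. (D $ i)\<^sup>2) \<le> (norm D)\<^sup>2"
      unfolding norm_power2_cart by (rule sum_mono2) auto
    then have "2 * lam * (\<Sum>i\<in>S. (D $ i)\<^sup>2) \<le> 2 * lam * (norm D)\<^sup>2"
      using \<open>lam > 0\<close> by (intro mult_left_mono) auto
    \<comment> \<open>Doubling \<open>main\<close> to clear \<open>gam / 2\<close> turns
      \<open>2 * lam\<close> into the \<open>4 * lam\<close> that \<open>gap\<close>
      controls.\<close>
    with main have "(gam - 4 * lam) * (norm D)\<^sup>2 \<le> 0" by (simp add: algebra_simps)
    then show ?thesis using gap by (simp add: mult_le_0_iff)
  qed
  then show ?thesis by (simp add: D_def)
qed

end
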